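(* Let $\kappa_1,\kappa_2,\kappa_3,I_1,\mathsf{P}>0$, $g_1\ne 0$, $I_3\neq 0$, and $g_2,I_2\in\mathbb{R}$. Then for any $\mathsf{R}\in\mathbb{R}$ the ODE for $\mathbf{X}=(X_1,\dots,X_5)\in\mathbb{R}^5$, $$\frac{d}{dt}\mathbf{X}=\begin{pmatrix} -\mathsf{P}\kappa_1 & 0 & \mathsf{P}\mathsf{R} g_1 & 0 & 0 \\ 0 & -\mathsf{P}\kappa_2 & 0 & \mathsf{P}\mathsf{R} g_2 & 0 \\ {g_1} & 0 & -\kappa_1 & 0 & 0 \\ 0 & g_2 & 0 & -\kappa_2 & 0 \\ 0 & 0 & 0 & 0 & -\kappa_3 \end{pmatrix}\mathbf{X}+\begin{pmatrix} I_1X_1X_2 \\ -I_1X_1^2 \\ {I_2}X_1X_4 \\ -I_2X_1X_3-I_3X_2X_5 \\ {I_3}X_2X_4 \end{pmatrix},$$ possesses a compact global attractor.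
   Context: A compact global attractor is a compact set, invariant under the flow, that attracts all bounded subsets of the phase space $\mathbb{R}^5$ as $t\to\infty$. *)

theory Defs
  imports "HOL-Analysis.Analysis"
begin

definition solves_ode_on ::
    "('a::real_normed_vector \<Rightarrow> 'a) \<Rightarrow> (real \<Rightarrow> 'a) \<Rightarrow> real set \<Rightarrow> bool" where
  "solves_ode_on F x T \<longleftrightarrow> (\<forall>t\<in>T. (x has_vector_derivative F (x t)) (at t within T))"

text \<open>
  \<open>\<phi> t x\<close> is the state at time \<open>t\<close> of the solution starting at \<open>x\<close>. The flow is global in time, and
  the last clause says that every solution on an interval around time \<open>0\<close>, including one-sided
  intervals such as \<open>{0..}\<close>, is a restriction of the flow line through its initial value. So \<open>F\<close>
  determines \<open>\<phi>\<close>, and the group law \<open>\<phi> (s + t) = \<phi> s \<circ> \<phi> t\<close> is a consequence.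
\<close>
definition is_flow_of ::
    "('a::real_normed_vector \<Rightarrow> 'a) \<Rightarrow> (real \<Rightarrow> 'a \<Rightarrow> 'a) \<Rightarrow> bool" where
  "is_flow_of F \<phi> \<longleftrightarrow>
     (\<forall>x. \<phi> 0 x = x \<and> solves_ode_on F (\<lambda>t. \<phi> t x) UNIV) \<and>
     (\<forall>y T. is_interval T \<and> 0 \<in> T \<and> solves_ode_on F y T \<longrightarrow> (\<forall>t\<in>T. y t = \<phi> t (y 0)))"

text \<open>
  The last clause says that the Hausdorff semi-distance \<open>sup\<^sub>x inf\<^sub>a dist (\<phi> t x) a\<close> from \<open>\<phi> t ` B\<close>
  to \<open>A\<close> tends to \<open>0\<close>. The explicit witness \<open>a\<close>, in place of \<open>infdist\<close> (which is \<open>0\<close> for the empty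
  set), prevents the empty set from being an attractor.
\<close>
definition compact_global_attractor ::
    "(real \<Rightarrow> 'a::real_normed_vector \<Rightarrow> 'a) \<Rightarrow> 'a set \<Rightarrow> bool" where
  "compact_global_attractor \<phi> A \<longleftrightarrow>
     compact A \<and>
     (\<forall>t. \<phi> t ` A = A) \<and>
     (\<forall>B. bounded B \<longrightarrow> (\<forall>e>0. \<forall>\<^sub>F t in at_top. \<forall>x\<in>B. \<exists>a\<in>A. dist (\<phi> t x) a < e))"

definition possesses_compact_global_attractor :: "('a::real_normed_vector \<Rightarrow> 'a) \<Rightarrow> bool" where
  "possesses_compact_global_attractor F \<longleftrightarrow>
     (\<exists>\<phi>. is_flow_of F \<phi> \<and> (\<exists>A. compact_global_attractor \<phi> A))"

end

theory Submission
  imports Defs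
begin

text \<open>
  The quadratic part is orthogonal to \<open>X\<close>, so \<open>\<bar>X\<bar>\<close> grows at most exponentially in both time directions
  and the flow is global. For dissipativity, measure the distance to a shifted centre
  \<open>c = (0, c\<^sub>2, 0, 0, c\<^sub>5)\<close>: the shift in the second coordinate turns \<open>I\<^sub>1\<close> into an additional damping
  \<open>c\<^sub>2 * I\<^sub>1 * X\<^sub>1\<^sup>2\<close> (with \<open>c\<^sub>2\<close> very negative) that absorbs the \<open>X\<^sub>1 * X\<^sub>3\<close> term for every \<open>R\<close>, and the shift
  in the fifth uses \<open>I\<^sub>3 \<noteq> 0\<close> to cancel the \<open>X\<^sub>2 * X\<^sub>4\<close> term. Hence a closed ball \<open>K\<close> around \<open>c\<close> is
  forward invariant and absorbs bounded sets, and \<open>\<Inter>t\<ge>0. \<phi> t ` K\<close> is the attractor.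
\<close>

section \<open>Solutions of ordinary differential equations\<close>

lemma solves_ode_on_subset:
  "solves_ode_on F y T \<Longrightarrow> S \<subseteq> T \<Longrightarrow> solves_ode_on F y S"
  unfolding solves_ode_on_def by (blast intro: has_vector_derivative_within_subset)

lemma solves_ode_on_shift:
  assumes "solves_ode_on F y UNIV"
  shows "solves_ode_on F (\<lambda>t. y (t + s)) UNIV"
  unfolding solves_ode_on_def
proof
  fix t
  have "(y has_vector_derivative F (y (t + s))) (at (t + s))"
    using assms by (simp add: solves_ode_on_def)
  then have "((y \<circ> (\<lambda>t. t + s)) has_vector_derivative 1 *\<^sub>R F (y (t + s))) (at t)"
    by (intro vector_diff_chain_at) (auto intro!: derivative_eq_intros)
  then show "((\<lambda>t. y (t + s)) has_vector_derivative F (y (t + s))) (at t)"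
    by (simp add: o_def)
qed

text \<open>Lets claims about negative times be reduced to claims about positive times, with
  \<open>- F\<close> in place of \<open>F\<close>.\<close>

lemma solves_ode_on_reverse:
  assumes "solves_ode_on F y T"
  shows "solves_ode_on (\<lambda>x. - F x) (\<lambda>t. y (- t)) (uminus ` T)"
  unfolding solves_ode_on_def
proof
  fix t assume t: "t \<in> uminus ` T"
  then have "(y has_vector_derivative F (y (- t))) (at (- t) within uminus ` uminus ` T)"
    using assms by (auto simp: solves_ode_on_def image_image)
  then have "((y \<circ> uminus) has_vector_derivative (- 1) *\<^sub>R F (y (- t))) (at t within uminus ` T)"
    by (intro vector_diff_chain_within) (auto intro!: derivative_eq_intros)
  then show "((\<lambda>t. y (- t)) has_vector_derivative - F (y (- t))) (at t within uminus ` T)"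
    by (simp add: o_def)
qed

section \<open>Gronwall estimates, uniqueness and growth bounds\<close>

lemma gronwall_Icc:
  fixes u :: "real \<Rightarrow> real"
  assumes "a \<le> b"
    and u: "\<And>t. t \<in> {a..b} \<Longrightarrow> (u has_real_derivative u' t) (at t within {a..b})"
    and le: "\<And>t. t \<in> {a..b} \<Longrightarrow> u' t \<le> k * u t"
  shows "u b \<le> u a * exp (k * (b - a))"
proof -
  \<comment> \<open>The integrating factor makes \<open>?v\<close> nonincreasing whatever the signs
    of \<open>k\<close> and \<open>u\<close>; the dissipative estimate later uses a negative
    \<open>k\<close> and a \<open>u\<close> that may change sign.\<close>
  let ?v = "\<lambda>t. u t * exp (- k * t)"
  have "?v b \<le> ?v a"
  proof (rule DERIV_nonpos_imp_decreasing_open[OF \<open>a \<le> b\<close>])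
    show "\<exists>y. (?v has_real_derivative y) (at t) \<and> y \<le> 0" if "a < t" "t < b" for t
    proof (intro exI conjI)
      have "(u has_real_derivative u' t) (at t)"
        using u[of t] that by (simp add: at_within_Icc_at)
      then show "(?v has_real_derivative (u' t - k * u t) * exp (- k * t)) (at t)"
        by (auto intro!: derivative_eq_intros simp: algebra_simps)
      show "(u' t - k * u t) * exp (- k * t) \<le> 0"
        using le[of t] that by (intro mult_nonpos_nonneg) auto
    qed
    have "continuous_on {a..b} u"
      using u DERIV_continuous_on by blast
    then show "continuous_on {a..b} ?v"
      by (intro continuous_intros)
  qed
  then have "?v b * exp (k * b) \<le> ?v a * exp (k * b)"
    by (intro mult_right_mono) auto
  then show ?thesis
    by (simp add: mult.assoc flip: exp_add) (simp add: algebra_simps)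
qed

lemma has_real_derivative_norm_power2:
  fixes y :: "real \<Rightarrow> 'a::real_inner"
  assumes "(y has_vector_derivative y') (at t within T)"
  shows "((\<lambda>t. (norm (y t - c))\<^sup>2) has_real_derivative 2 * ((y t - c) \<bullet> y')) (at t within T)"
proof -
  have "((\<lambda>t. (y t - c) \<bullet> (y t - c)) has_derivative
      (\<lambda>h. (y t - c) \<bullet> (h *\<^sub>R y') + (h *\<^sub>R y') \<bullet> (y t - c))) (at t within T)"
    using assms unfolding has_vector_derivative_def
    by (auto intro!: derivative_eq_intros)
  then show ?thesis
    unfolding has_field_derivative_def power2_norm_eq_inner
    by (rule has_derivative_eq_rhs) (auto simp: inner_commute algebra_simps)
qed

lemma lipschitz_on_inner_le:
  fixes F :: "'a::real_inner \<Rightarrow> 'a"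
  assumes "L-lipschitz_on S F" "x \<in> S" "y \<in> S"
  shows "(x - y) \<bullet> (F x - F y) \<le> L * (norm (x - y))\<^sup>2"
proof -
  have "(x - y) \<bullet> (F x - F y) \<le> norm (x - y) * norm (F x - F y)"
    by (rule norm_cauchy_schwarz)
  also have "\<dots> \<le> norm (x - y) * (L * norm (x - y))"
    using lipschitz_on_normD[OF assms] by (intro mult_left_mono) auto
  finally show ?thesis
    by (simp add: power2_eq_square algebra_simps)
qed

text \<open>Gronwall for the squared distance, which stays differentiable where the two solutions
  meet. It yields both uniqueness and continuity in the initial value.\<close>

lemma solves_ode_on_dist_le:
  fixes F :: "'a::real_inner \<Rightarrow> 'a"
  assumes lip: "L-lipschitz_on S F" and "0 \<le> b"
    and y: "solves_ode_on F y {0..b}" "y ` {0..b} \<subseteq> S"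
    and z: "solves_ode_on F z {0..b}" "z ` {0..b} \<subseteq> S"
  shows "dist (y b) (z b) \<le> exp (L * b) * dist (y 0) (z 0)"
proof -
  define d where "d t = (norm (y t - z t - 0))\<^sup>2" for t
  have "d b \<le> d 0 * exp (2 * L * (b - 0))"
  proof (rule gronwall_Icc[OF \<open>0 \<le> b\<close>])
    fix t assume t: "t \<in> {0..b}"
    have "((\<lambda>t. y t - z t) has_vector_derivative (F (y t) - F (z t))) (at t within {0..b})"
      using y(1) z(1) t unfolding solves_ode_on_def by (intro has_vector_derivative_diff) auto
    then show "(d has_real_derivative 2 * ((y t - z t - 0) \<bullet> (F (y t) - F (z t)))) (at t within {0..b})"
      unfolding d_def by (rule has_real_derivative_norm_power2)
    show "2 * ((y t - z t - 0) \<bullet> (F (y t) - F (z t))) \<le> 2 * L * d t"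
      using lipschitz_on_inner_le[OF lip, of "y t" "z t"] y(2) z(2) t
      by (simp add: d_def image_subset_iff)
  qed
  moreover have "exp (2 * L * b) = (exp (L * b))\<^sup>2"
    by (simp add: mult.assoc exp_double)
  ultimately have "(dist (y b) (z b))\<^sup>2 \<le> (exp (L * b) * dist (y 0) (z 0))\<^sup>2"
    by (simp add: d_def dist_norm power_mult_distrib mult.commute)
  then show ?thesis
    by (rule power2_le_imp_le) auto
qed

text \<open>Stands in for local Lipschitz continuity, as a quadratic field need not have a global
  constant. A bounded piece of trajectory lies in one ball, so a single \<open>L\<close> serves for
  it.\<close>

definition lipschitz_on_balls :: "('a::real_normed_vector \<Rightarrow> 'b::metric_space) \<Rightarrow> bool" where
  "lipschitz_on_balls F \<longleftrightarrow> (\<forall>M. \<exists>L. L-lipschitz_on (cball 0 M) F)"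

lemma solves_ode_on_continuous_on:
  "solves_ode_on F y T \<Longrightarrow> continuous_on T y"
  unfolding solves_ode_on_def continuous_on_eq_continuous_within
  by (blast intro: has_vector_derivative_continuous)

lemma solves_ode_on_unique_forward:
  fixes F :: "'a::real_inner \<Rightarrow> 'a"
  assumes F: "lipschitz_on_balls F" and "0 \<le> b"
    and y: "solves_ode_on F y {0..b}" and z: "solves_ode_on F z {0..b}" and "y 0 = z 0"
  shows "y b = z b"
proof -
  \<comment> \<open>Trajectories over a compact interval are compact, so one ball holds both of
    them.\<close>
  have "bounded (y ` {0..b} \<union> z ` {0..b})"
    using y z by (auto intro!: compact_imp_bounded compact_continuous_image
        dest: solves_ode_on_continuous_on)
  then obtain M where M: "y ` {0..b} \<union> z ` {0..b} \<subseteq> cball 0 M"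
    by (auto simp: bounded_iff subset_iff)
  obtain L where "L-lipschitz_on (cball 0 M) F"
    using F lipschitz_on_balls_def by blast
  from solves_ode_on_dist_le[OF this \<open>0 \<le> b\<close> y _ z] M show ?thesis
    using \<open>y 0 = z 0\<close> by auto
qed

lemma solves_ode_on_unique:
  fixes F :: "'a::real_inner \<Rightarrow> 'a"
  assumes F: "lipschitz_on_balls F"
    and T: "is_interval T" "0 \<in> T" "t \<in> T"
    and y: "solves_ode_on F y T" and z: "solves_ode_on F z T" and "y 0 = z 0"
  shows "y t = z t"
proof (cases "0 \<le> t")
  case True
  have "{0..t} \<subseteq> T"
    using mem_is_interval_1_I[OF T(1) T(2) T(3)] by auto
  with solves_ode_on_unique_forward[OF F True] y z \<open>y 0 = z 0\<close> show ?thesis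
    by (blast intro: solves_ode_on_subset)
next
  case False
  \<comment> \<open>For negative \<open>t\<close> both solutions are reflected in time and compared
    forward.\<close>
  have "{0..-t} \<subseteq> uminus ` T"
  proof
    fix s assume "s \<in> {0..-t}"
    then have "- s \<in> T"
      using mem_is_interval_1_I[OF T(1) T(3) T(2), of "- s"] by simp
    then show "s \<in> uminus ` T"
      by force
  qed
  then have "solves_ode_on (\<lambda>x. - F x) (\<lambda>t. y (- t)) {0..-t}"
    "solves_ode_on (\<lambda>x. - F x) (\<lambda>t. z (- t)) {0..-t}"
    using y z by (blast intro: solves_ode_on_subset solves_ode_on_reverse)+
  moreover have "lipschitz_on_balls (\<lambda>x. - F x)"
    using F by (simp add: lipschitz_on_balls_def)
  ultimately have "y (- (- t)) = z (- (- t))"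
    using False \<open>y 0 = z 0\<close>
    by (intro solves_ode_on_unique_forward[of _ "- t" "\<lambda>t. y (- t)" "\<lambda>t. z (- t)"]) auto
  then show ?thesis by simp
qed

lemma solves_ode_on_norm_le_forward:
  fixes F :: "'a::real_inner \<Rightarrow> 'a"
  assumes F: "\<And>x. x \<bullet> F x \<le> C * (norm x)\<^sup>2" and "0 \<le> b" and y: "solves_ode_on F y {0..b}"
  shows "norm (y b) \<le> norm (y 0) * exp (C * b)"
proof -
  have "(norm (y b - 0))\<^sup>2 \<le> (norm (y 0 - 0))\<^sup>2 * exp (2 * C * (b - 0))"
  proof (rule gronwall_Icc[OF \<open>0 \<le> b\<close>])
    fix t assume t: "t \<in> {0..b}"
    show "((\<lambda>t. (norm (y t - 0))\<^sup>2) has_real_derivative 2 * ((y t - 0) \<bullet> F (y t))) (at t within {0..b})"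
      using y t unfolding solves_ode_on_def by (intro has_real_derivative_norm_power2) auto
    show "2 * ((y t - 0) \<bullet> F (y t)) \<le> 2 * C * (norm (y t - 0))\<^sup>2"
      using F[of "y t"] by simp
  qed
  moreover have "exp (2 * C * b) = (exp (C * b))\<^sup>2"
    by (simp add: mult.assoc exp_double)
  ultimately have "(norm (y b))\<^sup>2 \<le> (norm (y 0) * exp (C * b))\<^sup>2"
    by (simp add: power_mult_distrib)
  then show ?thesis
    by (rule power2_le_imp_le) auto
qed

text \<open>Reversing time flips the sign of \<open>x \<bullet> F x\<close>, so bounding its
  absolute value controls the growth in both time directions.\<close>

lemma solves_ode_on_norm_le:
  fixes F :: "'a::real_inner \<Rightarrow> 'a"
  assumes F: "\<And>x. \<bar>x \<bullet> F x\<bar> \<le> C * (norm x)\<^sup>2" and y: "solves_ode_on F y UNIV"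
  shows "norm (y t) \<le> norm (y 0) * exp (C * \<bar>t\<bar>)"
proof (cases "0 \<le> t")
  case True
  with solves_ode_on_norm_le_forward[of F C t y] F y show ?thesis
    by (metis abs_le_D1 abs_of_nonneg solves_ode_on_subset top_greatest)
next
  case False
  have "solves_ode_on (\<lambda>x. - F x) (\<lambda>t. y (- t)) {0..-t}"
    using solves_ode_on_reverse[OF y] by (rule solves_ode_on_subset) (auto simp: surj_def)
  moreover have "x \<bullet> (- F x) \<le> C * (norm x)\<^sup>2" for x
    using F[of x] by (simp add: abs_le_iff)
  ultimately show ?thesis
    using False solves_ode_on_norm_le_forward[of "\<lambda>x. - F x" C "- t" "\<lambda>t. y (- t)"] by simp
qed

section \<open>Global existence by a weighted Picard iteration\<close>

lemma antiderivative_exists: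
  fixes f :: "real \<Rightarrow> 'a::euclidean_space"
  assumes "continuous_on UNIV f"
  shows "\<exists>G. G 0 = 0 \<and> (\<forall>t. (G has_vector_derivative f t) (at t))"
proof -
  define G where "G u = (LBINT y=ereal 0..ereal u. f y)" for u
  have "(G has_vector_derivative f t) (at t)" for t
  proof -
    \<comment> \<open>The interval contains the base point \<open>0\<close> and has \<open>t\<close>
      in its interior, so the derivative within it is a full derivative.\<close>
    have "(G has_vector_derivative f t) (at t within {-\<bar>t\<bar>-1..\<bar>t\<bar>+1})"
      unfolding G_def using assms
      by (intro interval_integral_FTC2) (auto intro: continuous_on_subset)
    moreover have "at t within {-\<bar>t\<bar>-1..\<bar>t\<bar>+1} = at t"
      by (rule at_within_Icc_at) auto
    ultimately show ?thesis
      by simp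
  qed
  moreover have "G 0 = 0"
    by (simp add: G_def)
  ultimately show ?thesis
    by blast
qed

text \<open>Mean value inequality against the antiderivative of the majorant. The gained factor
  \<open>1 / K\<close> is what makes the Picard operator contract.\<close>

lemma norm_antiderivative_le_forward:
  fixes G :: "real \<Rightarrow> 'a::real_normed_vector"
  assumes G: "\<And>t. (G has_vector_derivative g t) (at t)" "G 0 = 0"
    and K: "K > 0" "M \<ge> 0" and g: "\<And>t. norm (g t) \<le> M * exp (K * \<bar>t\<bar>)" and t: "t > 0"
  shows "norm (G t) \<le> M / K * exp (K * t)"
proof -
  have "norm (G t - G 0) \<le> M / K * exp (K * t) - M / K * exp (K * 0)"
  proof (rule differentiable_bound_general[OF t])
    show "continuous_on {0..t} G"
      using G(1) by (intro continuous_at_imp_continuous_on ballI has_vector_derivative_continuous)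
    show "((\<lambda>s. M / K * exp (K * s)) has_vector_derivative M * exp (K * s)) (at s)" for s
      using K by (auto intro!: derivative_eq_intros simp flip: has_real_derivative_iff_has_vector_derivative)
    show "norm (g s) \<le> M * exp (K * s)" if "0 < s" for s
      using g[of s] that by simp
    show "continuous_on {0..t} (\<lambda>s. M / K * exp (K * s))"
      by (intro continuous_intros)
  qed (rule G)
  also have "\<dots> \<le> M / K * exp (K * t)"
    using K by simp
  finally show ?thesis
    using G(2) by simp
qed

lemma norm_antiderivative_le:
  fixes G :: "real \<Rightarrow> 'a::real_normed_vector"
  assumes G: "\<And>t. (G has_vector_derivative g t) (at t)" "G 0 = 0"
    and K: "K > 0" "M \<ge> 0" and g: "\<And>t. norm (g t) \<le> M * exp (K * \<bar>t\<bar>)"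
  shows "norm (G t) \<le> M / K * exp (K * \<bar>t\<bar>)"
proof -
  consider "t > 0" | "t < 0" | "t = 0" by linarith
  then show ?thesis
  proof cases
    case 1
    with norm_antiderivative_le_forward[OF assms] show ?thesis by simp
  next
    case 2
    \<comment> \<open>The reflected function vanishes at \<open>0\<close> and has derivative
      \<open>g (- s)\<close>, which obeys the same even bound.\<close>
    have "((\<lambda>t. - G (- t)) has_vector_derivative g (- s)) (at s)" for s
    proof -
      have "((G \<circ> uminus) has_vector_derivative (- 1) *\<^sub>R g (- s)) (at s)"
        using G(1) by (intro vector_diff_chain_at) (auto intro!: derivative_eq_intros)
      from has_vector_derivative_minus[OF this] show ?thesis
        by (simp add: o_def)
    qed
    from norm_antiderivative_le_forward[OF this, of K M "- t"] 2 K G(2) g[of "- s" for s]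
    show ?thesis by simp
  qed (use K G(2) in auto)
qed

text \<open>
  The unknown is \<open>u t = exp (- K * \<bar>t\<bar>) *\<^sub>R (y t - x)\<close>: in this weighted sup norm the Picard operator is
  a contraction on the whole real line at once, so no local solutions have to be continued.
\<close>
lemma lipschitz_ode_global_solution:
  fixes F :: "'a::euclidean_space \<Rightarrow> 'a"
  assumes L: "L-lipschitz_on UNIV F"
  obtains y where "y 0 = x" "solves_ode_on F y UNIV"
proof -
  have "L \<ge> 0"
    using L by (rule lipschitz_on_nonneg)
  \<comment> \<open>The contraction factor will be \<open>L / K\<close>, at most one half; the added
    \<open>1\<close> keeps \<open>K\<close> positive when \<open>L = 0\<close>.\<close>
  define K where "K = 2 * (L + 1)"
  have "K > 0"
    using \<open>L \<ge> 0\<close> by (simp add: K_def)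
  define w where "w t = exp (K * \<bar>t\<bar>)" for t :: real
  have w: "w t \<ge> 1" "w t > 0" for t
    using \<open>K > 0\<close> by (auto simp: w_def)
  have cont_w: "continuous_on UNIV w"
    unfolding w_def by (intro continuous_intros)
  \<comment> \<open>The argument of \<open>F\<close> is the curve \<open>y\<close> recovered from
    the weighted unknown \<open>u\<close>.\<close>
  define f where "f u t = F (x + w t *\<^sub>R apply_bcontfun u t)" for u t
  have "continuous_on UNIV (f u)" for u
    unfolding f_def using cont_w
    by (intro continuous_on_compose2[OF lipschitz_on_continuous_on[OF L]] continuous_intros) auto
  then have "\<forall>u. \<exists>G. G 0 = 0 \<and> (\<forall>t. (G has_vector_derivative f u t) (at t))"
    by (intro allI antiderivative_exists)
  then obtain G where G0: "\<And>u. G u 0 = 0"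
    and G: "\<And>u t. (G u has_vector_derivative f u t) (at t)"
    by metis
  \<comment> \<open>A Lipschitz field grows at most linearly, and \<open>w t \<ge> 1\<close> absorbs
    the constant \<open>norm (F x)\<close>. This keeps the Picard operator within the bounded
    functions.\<close>
  have growth: "norm (f u t) \<le> (norm (F x) + L * norm u) * w t" for u t
  proof -
    have "norm (f u t - F x) \<le> L * (w t * norm (apply_bcontfun u t))"
      unfolding f_def using lipschitz_on_normD[OF L, of "x + w t *\<^sub>R apply_bcontfun u t" x] w
      by (simp add: less_imp_le)
    also have "\<dots> \<le> L * (w t * norm u)"
      using \<open>L \<ge> 0\<close> w(2)[of t] by (intro mult_left_mono norm_bounded) auto
    finally have "norm (f u t) \<le> norm (F x) + L * (w t * norm u)"
      using norm_triangle_ineq2[of "f u t" "F x"] by linarith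
    also have "\<dots> \<le> norm (F x) * w t + L * (w t * norm u)"
      using mult_left_mono[OF w(1)[of t], of "norm (F x)"] by simp
    finally show ?thesis
      by (simp add: algebra_simps)
  qed
  have G_bound: "norm (G u t) \<le> (norm (F x) + L * norm u) / K * w t" for u t
    unfolding w_def using growth[of u, unfolded w_def] \<open>L \<ge> 0\<close>
    by (intro norm_antiderivative_le[OF G G0 \<open>K > 0\<close>]) auto
  have G_diff: "norm (G u t - G v t) \<le> (L * dist u v) / K * w t" for u v t
    unfolding w_def
  proof (rule norm_antiderivative_le[OF has_vector_derivative_diff[OF G G] _ \<open>K > 0\<close>])
    fix t
    have "norm (f u t - f v t) \<le> L * (w t * norm (apply_bcontfun u t - apply_bcontfun v t))"
      using lipschitz_on_normD[OF L, of "x + w t *\<^sub>R apply_bcontfun u t"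
          "x + w t *\<^sub>R apply_bcontfun v t"] w(2)[of t]
      by (simp add: f_def flip: scaleR_diff_right)
    also have "\<dots> \<le> L * (w t * dist u v)"
      using \<open>L \<ge> 0\<close> w(2)[of t] dist_bounded[of u t v]
      by (intro mult_left_mono) (auto simp: dist_norm)
    finally show "norm (f u t - f v t) \<le> L * dist u v * exp (K * \<bar>t\<bar>)"
      by (simp add: w_def algebra_simps)
  qed (use \<open>L \<ge> 0\<close> G0 in auto)
  \<comment> \<open>The Picard operator in the weighted unknown.\<close>
  define S where "S u t = inverse (w t) *\<^sub>R G u t" for u t
  have "S u \<in> bcontfun" for u
  proof (rule bcontfun_normI)
    have "continuous_on UNIV (G u)"
      using G by (intro continuous_at_imp_continuous_on ballI has_vector_derivative_continuous)
    then show "continuous_on UNIV (S u)"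
      unfolding S_def using w(2) cont_w by (intro continuous_intros) (metis less_irrefl)+
    show "norm (S u t) \<le> (norm (F x) + L * norm u) / K" for t
      using G_bound[of u t] w(2)[of t] by (simp add: S_def field_simps)
  qed
  then have T: "apply_bcontfun (Bcontfun (S u)) = S u" for u
    by (simp add: Bcontfun_inverse)
  have "dist (Bcontfun (S u)) (Bcontfun (S v)) \<le> 1/2 * dist u v" for u v
  proof (rule dist_bound)
    fix t
    have "S u t - S v t = inverse (w t) *\<^sub>R (G u t - G v t)"
      by (simp add: S_def scaleR_diff_right)
    then have "norm (S u t - S v t) = norm (G u t - G v t) / w t"
      using w(2)[of t] by (simp add: divide_inverse mult.commute)
    also have "\<dots> \<le> (L * dist u v) / K"
      using G_diff[of u t v] w(2)[of t] by (simp add: pos_divide_le_eq)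
    also have "\<dots> \<le> 1/2 * dist u v"
      using \<open>L \<ge> 0\<close> by (simp add: K_def field_simps)
    finally show "dist (apply_bcontfun (Bcontfun (S u)) t) (apply_bcontfun (Bcontfun (S v)) t)
        \<le> 1/2 * dist u v"
      by (simp add: T dist_norm)
  qed
  then obtain u where "Bcontfun (S u) = u"
    using banach_fix_type[of "1/2" "\<lambda>u. Bcontfun (S u)"] by auto
  \<comment> \<open>At the fixed point, undoing the weight shows that the curve inside
    \<open>F\<close> is \<open>x + G u t\<close> itself.\<close>
  then have "w t *\<^sub>R apply_bcontfun u t = G u t" for t
    using T[of u] w(2)[of t] by (simp add: S_def)
  then have "f u t = F (x + G u t)" for t
    by (simp add: f_def)
  then have "((\<lambda>t. x + G u t) has_vector_derivative F (x + G u t)) (at t)" for t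
    using G[of u t] by (auto intro!: derivative_eq_intros)
  then show thesis
    using that[of "\<lambda>t. x + G u t"] G0 by (simp add: solves_ode_on_def)
qed

text \<open>Inside the ball \<open>l = 1\<close>; outside, the radial point at distance
  \<open>r\<close> is nearest by the reverse triangle inequality.\<close>

lemma closest_point_cball_0:
  fixes x :: "'a::euclidean_space"
  assumes "r > 0"
  obtains l where "l > 0" "closest_point (cball 0 r) x = l *\<^sub>R x"
proof (cases "norm x \<le> r")
  case True
  then show ?thesis
    using that[of 1] by (simp add: closest_point_self)
next
  case False
  then have "x \<noteq> 0"
    using assms by auto
  have "(r / norm x) *\<^sub>R x = closest_point (cball 0 r) x"
  proof (rule closest_point_unique)
    show "\<forall>z\<in>cball 0 r. dist x ((r / norm x) *\<^sub>R x) \<le> dist x z"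
    proof
      fix z :: 'a assume z: "z \<in> cball 0 r"
      have "x - (r / norm x) *\<^sub>R x = (1 - r / norm x) *\<^sub>R x"
        by (simp add: algebra_simps)
      then have "dist x ((r / norm x) *\<^sub>R x) = (1 - r / norm x) * norm x"
        using False assms \<open>x \<noteq> 0\<close> by (simp add: dist_norm)
      also have "\<dots> = norm x - r"
        using \<open>x \<noteq> 0\<close> by (simp add: left_diff_distrib)
      also have "\<dots> \<le> dist x z"
        using z norm_triangle_ineq2[of x z] by (simp add: dist_norm)
      finally show "dist x ((r / norm x) *\<^sub>R x) \<le> dist x z" .
    qed
  qed (use assms \<open>x \<noteq> 0\<close> in auto)
  then show ?thesis
    using that[of "r / norm x"] assms \<open>x \<noteq> 0\<close> by simp
qed

text \<open>
  \<open>F\<close> is composed with the retraction \<open>p\<close> onto a large ball. As \<open>p z\<close> is a positive multiple of \<open>z\<close>,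
  the truncated field satisfies the same bound on \<open>z \<bullet> F z\<close>, so on \<open>{-b..b}\<close> its solution stays in the
  ball, where the truncation is invisible.
\<close>
lemma ode_solution_Icc:
  fixes F :: "'a::euclidean_space \<Rightarrow> 'a"
  assumes lip: "lipschitz_on_balls F" and bound: "\<And>x. \<bar>x \<bullet> F x\<bar> \<le> C * (norm x)\<^sup>2"
  obtains y where "y 0 = x" "solves_ode_on F y {-b..b}"
proof -
  \<comment> \<open>Exceeds the a priori bound up to time \<open>b\<close>; the added
    \<open>1\<close> keeps \<open>r\<close> positive when \<open>x = 0\<close>.\<close>
  define r where "r = norm x * exp (\<bar>C\<bar> * b) + 1"
  have "r > 0"
    unfolding r_def by (intro add_nonneg_pos) auto
  define p where "p = closest_point (cball (0::'a) r)"
  have p_cball: "p z \<in> cball 0 r" for z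
    unfolding p_def using \<open>r > 0\<close> by (intro closest_point_in_set) auto
  obtain L where "L-lipschitz_on (cball 0 r) F"
    using lip lipschitz_on_balls_def by blast
  then have "L-lipschitz_on (range p) F"
    using p_cball by (auto intro: lipschitz_on_subset)
  moreover have "1-lipschitz_on UNIV p"
    unfolding p_def using \<open>r > 0\<close> by (intro lipschitz_onI) (auto intro: closest_point_lipschitz)
  ultimately have "(L * 1)-lipschitz_on UNIV (\<lambda>z. F (p z))"
    by (intro lipschitz_on_compose2)
  then obtain y where y: "y 0 = x" "solves_ode_on (\<lambda>z. F (p z)) y UNIV"
    by (rule lipschitz_ode_global_solution)
  have "\<bar>z \<bullet> F (p z)\<bar> \<le> \<bar>C\<bar> * (norm z)\<^sup>2" for z
  proof -
    obtain l where l: "l > 0" "p z = l *\<^sub>R z"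
      unfolding p_def using closest_point_cball_0[OF \<open>r > 0\<close>] by metis
    \<comment> \<open>A factor above one would put \<open>z\<close> inside the ball, where
      \<open>p\<close> fixes it.\<close>
    have "l \<le> 1 \<or> z = 0"
    proof (rule ccontr)
      assume "\<not> ?thesis"
      then have "norm z < norm (p z)"
        using l by simp
      moreover from this have "z \<in> cball 0 r"
        using p_cball[of z] by simp
      then have "p z = z"
        unfolding p_def by (rule closest_point_self)
      ultimately show False by simp
    qed
    \<comment> \<open>The hypothesis at \<open>p z\<close> carries \<open>l\<close> once on the left
      and twice on the right; one factor cancels and the other is at most one unless
      \<open>z = 0\<close>.\<close>
    have "l * \<bar>z \<bullet> F (p z)\<bar> = \<bar>p z \<bullet> F (p z)\<bar>"
      using l by (simp add: abs_mult)
    also have "\<dots> \<le> C * (norm (p z))\<^sup>2"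
      by (rule bound)
    also have "\<dots> \<le> \<bar>C\<bar> * (norm (p z))\<^sup>2"
      by (intro mult_right_mono) auto
    also have "\<dots> = l * (l * (\<bar>C\<bar> * (norm z)\<^sup>2))"
      using l by (simp add: power2_eq_square)
    finally have "\<bar>z \<bullet> F (p z)\<bar> \<le> l * (\<bar>C\<bar> * (norm z)\<^sup>2)"
      using l(1) by simp
    also have "\<dots> \<le> \<bar>C\<bar> * (norm z)\<^sup>2"
      using \<open>l \<le> 1 \<or> z = 0\<close> l(1) by (auto intro: mult_left_le_one_le)
    finally show ?thesis .
  qed
  note growth = solves_ode_on_norm_le[OF this y(2), unfolded y(1)]
  have "p (y t) = y t" if "t \<in> {-b..b}" for t
  proof -
    have "norm (y t) \<le> norm x * exp (\<bar>C\<bar> * \<bar>t\<bar>)"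
      by (rule growth)
    also have "\<dots> \<le> norm x * exp (\<bar>C\<bar> * b)"
      using that by (intro mult_left_mono iffD2[OF exp_le_cancel_iff]) auto
    finally show ?thesis
      unfolding p_def by (intro closest_point_self) (simp add: r_def)
  qed
  then have "solves_ode_on F y {-b..b}"
    using y(2) unfolding solves_ode_on_def
    by (metis UNIV_I has_vector_derivative_at_within)
  with y(1) show thesis
    by (rule that)
qed

text \<open>Solutions on growing intervals agree by uniqueness and can be glued.\<close>

lemma ode_solution_UNIV:
  fixes F :: "'a::euclidean_space \<Rightarrow> 'a"
  assumes lip: "lipschitz_on_balls F" and bound: "\<And>x. \<bar>x \<bullet> F x\<bar> \<le> C * (norm x)\<^sup>2"
  obtains y where "y 0 = x" "solves_ode_on F y UNIV"
proof -
  have "\<exists>z. z 0 = x \<and> solves_ode_on F z {-b..b}" for b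
    using ode_solution_Icc[OF assms] by metis
  then obtain z where z0: "\<And>b. z b 0 = x" and z: "\<And>b. solves_ode_on F (z b) {-b..b}"
    by metis
  define y where "y t = z \<bar>t\<bar> t" for t
  have y_eq: "y s = z b s" if "\<bar>s\<bar> \<le> b" for s b
    unfolding y_def
  proof (rule solves_ode_on_unique[OF lip _ _ _ z])
    show "solves_ode_on F (z b) {-\<bar>s\<bar>..\<bar>s\<bar>}"
      using z by (rule solves_ode_on_subset) (use that in auto)
  qed (auto simp: z0)
  have "(y has_vector_derivative F (y t)) (at t)" for t
  proof -
    \<comment> \<open>The added \<open>1\<close> places \<open>t\<close> in the interior of
      \<open>{-b..b}\<close>.\<close>
    define b where "b = \<bar>t\<bar> + 1"
    have t: "t \<in> {-b<..<b}"
      by (auto simp: b_def)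
    have "(z b has_vector_derivative F (z b t)) (at t within {-b..b})"
      using z[of b] t by (auto simp: solves_ode_on_def)
    then have "(z b has_vector_derivative F (y t)) (at t)"
      using y_eq[of t b] t by (simp add: at_within_Icc_at b_def)
    then show ?thesis
      using t
      by (rule has_vector_derivative_transform_within_open[OF _ open_greaterThanLessThan])
        (subst y_eq[of _ b], auto)
  qed
  then have "solves_ode_on F y UNIV"
    by (simp add: solves_ode_on_def)
  moreover have "y 0 = x"
    by (simp add: y_def z0)
  ultimately show thesis
    using that by blast
qed

section \<open>The flow, its group law and its continuity\<close>

lemma is_flow_of_exists:
  fixes F :: "'a::euclidean_space \<Rightarrow> 'a"
  assumes lip: "lipschitz_on_balls F" and bound: "\<And>x. \<bar>x \<bullet> F x\<bar> \<le> C * (norm x)\<^sup>2"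
  obtains \<phi> where "is_flow_of F \<phi>"
proof -
  have "\<exists>y. y 0 = x \<and> solves_ode_on F y UNIV" for x
    using ode_solution_UNIV[OF assms] by metis
  then obtain \<phi> where \<phi>: "\<And>x. \<phi> x 0 = x" "\<And>x. solves_ode_on F (\<phi> x) UNIV"
    by metis
  have "is_flow_of F (\<lambda>t x. \<phi> x t)"
    unfolding is_flow_of_def
  proof (intro conjI allI impI ballI)
    show "\<phi> x 0 = x" "solves_ode_on F (\<phi> x) UNIV" for x
      by (rule \<phi>)+
    fix y T t
    assume *: "is_interval T \<and> 0 \<in> T \<and> solves_ode_on F y T" and "t \<in> T"
    show "y t = \<phi> (y 0) t"
    proof (rule solves_ode_on_unique[OF lip])
      show "solves_ode_on F (\<phi> (y 0)) T"
        using \<phi>(2) subset_UNIV by (rule solves_ode_on_subset)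
    qed (use * \<open>t \<in> T\<close> \<phi>(1) in auto)
  qed
  then show thesis
    by (rule that)
qed

text \<open>The field is autonomous, so a shifted flow line is again a solution, and the uniqueness
  clause identifies it.\<close>

lemma is_flow_of_add:
  assumes "is_flow_of F \<phi>"
  shows "\<phi> (s + t) x = \<phi> s (\<phi> t x)"
proof -
  have "solves_ode_on F (\<lambda>s. \<phi> (s + t) x) UNIV"
    using assms by (intro solves_ode_on_shift) (simp add: is_flow_of_def)
  moreover have "\<forall>y T. is_interval T \<and> 0 \<in> T \<and> solves_ode_on F y T \<longrightarrow> (\<forall>t\<in>T. y t = \<phi> t (y 0))"
    using assms by (simp add: is_flow_of_def)
  ultimately have "\<forall>s\<in>UNIV. \<phi> (s + t) x = \<phi> s (\<phi> (0 + t) x)"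
    using is_interval_univ by blast
  then show ?thesis
    by simp
qed

lemma is_flow_of_continuous_on:
  fixes F :: "'a::real_inner \<Rightarrow> 'a"
  assumes lip: "lipschitz_on_balls F" and bound: "\<And>x. x \<bullet> F x \<le> C * (norm x)\<^sup>2"
    and \<phi>: "is_flow_of F \<phi>" and "0 \<le> t"
  shows "continuous_on (cball 0 r) (\<phi> t)"
proof -
  have sol: "solves_ode_on F (\<lambda>t. \<phi> t x) {0..b}" and \<phi>0: "\<phi> 0 x = x" for x b
    using \<phi> solves_ode_on_subset[OF _ subset_UNIV] unfolding is_flow_of_def by blast+
  define M where "M = r * exp (\<bar>C\<bar> * t)"
  have M: "(\<lambda>t. \<phi> t x) ` {0..t} \<subseteq> cball 0 M" if "x \<in> cball 0 r" for x
  proof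
    fix y assume "y \<in> (\<lambda>t. \<phi> t x) ` {0..t}"
    then obtain s where s: "0 \<le> s" "s \<le> t" "y = \<phi> s x" by auto
    \<comment> \<open>Passing to \<open>\<bar>C\<bar>\<close> makes the growth factor monotone, so
      the bound at time \<open>t\<close> covers all earlier \<open>s\<close>.\<close>
    have "z \<bullet> F z \<le> \<bar>C\<bar> * (norm z)\<^sup>2" for z
      using bound[of z] by (rule order_trans) (intro mult_right_mono, auto)
    from solves_ode_on_norm_le_forward[OF this s(1) sol]
    have "norm (\<phi> s x) \<le> norm x * exp (\<bar>C\<bar> * s)"
      by (simp add: \<phi>0)
    also have "\<dots> \<le> r * exp (\<bar>C\<bar> * t)"
      using that s by (intro mult_mono) (auto intro: mult_left_mono order_trans[OF norm_ge_zero])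
    finally show "y \<in> cball 0 M"
      by (simp add: M_def s)
  qed
  obtain L where L: "L-lipschitz_on (cball 0 M) F"
    using lip lipschitz_on_balls_def by blast
  have "(exp (L * t))-lipschitz_on (cball 0 r) (\<phi> t)"
    using solves_ode_on_dist_le[OF L \<open>0 \<le> t\<close> sol M sol M] by (intro lipschitz_onI) (auto simp: \<phi>0)
  then show ?thesis
    by (rule lipschitz_on_continuous_on)
qed

section \<open>Attractors of dissipative systems\<close>

text \<open>The images of \<open>K\<close> form a decreasing family of compact sets, so a
  neighbourhood of their intersection contains one of them.\<close>

lemma compact_global_attractor_exists:
  fixes \<phi> :: "real \<Rightarrow> 'a::euclidean_space \<Rightarrow> 'a"
  assumes zero: "\<And>x. \<phi> 0 x = x" and add: "\<And>s t x. \<phi> (s + t) x = \<phi> s (\<phi> t x)"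
    and K: "compact K" "\<And>t. 0 \<le> t \<Longrightarrow> continuous_on K (\<phi> t)" "\<And>t. 0 \<le> t \<Longrightarrow> \<phi> t ` K \<subseteq> K"
    and absorbing: "\<And>B. bounded B \<Longrightarrow> \<exists>T. \<forall>t\<ge>T. \<phi> t ` B \<subseteq> K"
  shows "compact_global_attractor \<phi> (\<Inter>t\<in>{0..}. \<phi> t ` K)"
    (is "compact_global_attractor \<phi> ?A")
proof -
  have mono: "\<phi> t ` K \<subseteq> \<phi> s ` K" if "0 \<le> s" "s \<le> t" for s t
  proof -
    have "\<phi> t ` K = \<phi> s ` \<phi> (t - s) ` K"
      using add[of s "t - s"] by (simp add: image_image)
    also have "\<dots> \<subseteq> \<phi> s ` K"
      using that K(3)[of "t - s"] by (intro image_mono) auto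
    finally show ?thesis .
  qed
  have compact: "compact (\<phi> t ` K)" if "0 \<le> t" for t
    using that K by (intro compact_continuous_image)
  have compact_A: "compact ?A"
    by (rule compact_Inter) (auto intro: compact)
  \<comment> \<open>Holds for negative \<open>s\<close> too: a point of \<open>?A\<close> lies in
    the image of \<open>K\<close> at time \<open>max 0 (t - s)\<close>, and flowing on for
    \<open>s\<close> leads to time \<open>max s t\<close>, at least \<open>t\<close>.\<close>
  have sub: "\<phi> s ` ?A \<subseteq> ?A" for s
  proof (intro subsetI INT_I)
    fix y t assume "y \<in> \<phi> s ` ?A" "t \<in> {0::real..}"
    then obtain x where x: "x \<in> ?A" "y = \<phi> s x" and t: "0 \<le> t"
      by auto
    from x(1) have "x \<in> \<phi> (max 0 (t - s)) ` K"
      by auto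
    then have "y \<in> \<phi> (s + max 0 (t - s)) ` K"
      using x(2) by (auto simp: add)
    then show "y \<in> \<phi> t ` K"
      using mono[OF t, of "s + max 0 (t - s)"] by force
  qed
  \<comment> \<open>The previous inclusion at \<open>- s\<close>, inverted by the group law.\<close>
  have sup: "?A \<subseteq> \<phi> s ` ?A" for s
  proof
    fix x assume "x \<in> ?A"
    then have "\<phi> (- s) x \<in> ?A"
      using sub by blast
    moreover have "x = \<phi> s (\<phi> (- s) x)"
      using add[of s "- s" x] by (simp add: zero)
    ultimately show "x \<in> \<phi> s ` ?A"
      by blast
  qed
  have attracts: "\<forall>\<^sub>F t in at_top. \<forall>x\<in>B. \<exists>a\<in>?A. dist (\<phi> t x) a < e"
    if "bounded B" "e > 0" for B and e :: real
  proof -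
    define U where "U = (\<Union>a\<in>?A. ball a e)"
    \<comment> \<open>Otherwise the nested compact sets left outside the open set \<open>U\<close>
      share a point, which lies in \<open>?A\<close> and hence in \<open>U\<close>.\<close>
    have "\<exists>n. \<phi> (real n) ` K \<subseteq> U"
    proof (rule ccontr)
      assume "\<nexists>n. \<phi> (real n) ` K \<subseteq> U"
      then have "\<Inter> (range (\<lambda>n. \<phi> (real n) ` K - U)) \<noteq> {}"
      proof (intro compact_nest)
        show "compact (\<phi> (real n) ` K - U)" for n
          using compact by (intro compact_diff) (auto simp: U_def)
        show "\<phi> (real n) ` K - U \<subseteq> \<phi> (real m) ` K - U" if "m \<le> n" for m n
          using mono[of "real m" "real n"] that by auto
      qed auto
      then obtain x where x: "\<And>n. x \<in> \<phi> (real n) ` K - U"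
        by auto
      have "x \<in> ?A"
      proof
        fix t assume "t \<in> {0::real..}"
        moreover obtain n where "t \<le> real n"
          using real_arch_simple by blast
        ultimately show "x \<in> \<phi> t ` K"
          using mono[of t "real n"] x[of n] by auto
      qed
      then have "x \<in> U"
        unfolding U_def using \<open>e > 0\<close> by (intro UN_I) auto
      then show False
        using x by blast
    qed
    then obtain n where n: "\<phi> (real n) ` K \<subseteq> U" by blast
    obtain T where T: "\<And>t. t \<ge> T \<Longrightarrow> \<phi> t ` B \<subseteq> K"
      using absorbing[OF \<open>bounded B\<close>] by blast
    \<comment> \<open>The first \<open>t - real n\<close> units of time bring \<open>B\<close> into
      \<open>K\<close>, the remaining \<open>real n\<close> bring \<open>K\<close> into
      \<open>U\<close>.\<close>
    have "\<exists>a\<in>?A. dist (\<phi> t x) a < e" if "t \<ge> T + real n" "x \<in> B" for t x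
    proof -
      have "\<phi> (t - real n) x \<in> K"
        using T[of "t - real n"] that by auto
      moreover have "\<phi> t x = \<phi> (real n) (\<phi> (t - real n) x)"
        using add[of "real n" "t - real n" x] by simp
      ultimately have "\<phi> t x \<in> U"
        using n by blast
      then obtain a where "a \<in> ?A" "dist a (\<phi> t x) < e"
        unfolding U_def by (meson UN_E mem_ball)
      then show ?thesis
        by (metis dist_commute)
    qed
    then show ?thesis
      by (intro eventually_mono[OF eventually_ge_at_top[of "T + real n"]]) blast
  qed
  show ?thesis
    unfolding compact_global_attractor_def
  proof (intro conjI allI impI)
    show "\<phi> t ` ?A = ?A" for t
      using sub sup by (rule subset_antisym)
  qed (fact compact_A attracts)+
qed

text \<open>Gronwall for the excess of the squared distance over the level
  \<open>\<kappa> / \<delta>\<close>, at which damping and forcing balance.\<close>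

lemma solves_ode_on_dissipative_le:
  fixes F :: "'a::real_inner \<Rightarrow> 'a"
  assumes "\<delta> > 0" and F: "\<And>x. (x - c) \<bullet> F x \<le> \<kappa> - \<delta> * (norm (x - c))\<^sup>2"
    and "0 \<le> b" and y: "solves_ode_on F y {0..b}"
  shows "(norm (y b - c))\<^sup>2 - \<kappa> / \<delta> \<le> ((norm (y 0 - c))\<^sup>2 - \<kappa> / \<delta>) * exp (- 2 * \<delta> * b)"
proof -
  have "(norm (y b - c))\<^sup>2 - \<kappa> / \<delta> \<le> ((norm (y 0 - c))\<^sup>2 - \<kappa> / \<delta>) * exp (- 2 * \<delta> * (b - 0))"
  proof (rule gronwall_Icc[OF \<open>0 \<le> b\<close>])
    fix t assume t: "t \<in> {0..b}"
    have "((\<lambda>t. (norm (y t - c))\<^sup>2) has_real_derivative 2 * ((y t - c) \<bullet> F (y t))) (at t within {0..b})"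
      using y t unfolding solves_ode_on_def by (intro has_real_derivative_norm_power2) auto
    from DERIV_diff[OF this DERIV_const[of "\<kappa> / \<delta>"]]
    show "((\<lambda>t. (norm (y t - c))\<^sup>2 - \<kappa> / \<delta>) has_real_derivative 2 * ((y t - c) \<bullet> F (y t)))
        (at t within {0..b})"
      by simp
    show "2 * ((y t - c) \<bullet> F (y t)) \<le> - 2 * \<delta> * ((norm (y t - c))\<^sup>2 - \<kappa> / \<delta>)"
      using F[of "y t"] \<open>\<delta> > 0\<close> by (simp add: right_diff_distrib)
  qed
  then show ?thesis by simp
qed

theorem dissipative_possesses_compact_global_attractor:
  fixes F :: "'a::euclidean_space \<Rightarrow> 'a"
  assumes lip: "lipschitz_on_balls F" and bound: "\<And>x. \<bar>x \<bullet> F x\<bar> \<le> C * (norm x)\<^sup>2"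
    and "\<delta> > 0" and F: "\<And>x. (x - c) \<bullet> F x \<le> \<kappa> - \<delta> * (norm (x - c))\<^sup>2"
  shows "possesses_compact_global_attractor F"
proof -
  obtain \<phi> where \<phi>: "is_flow_of F \<phi>"
    using is_flow_of_exists[OF lip bound] .
  then have zero: "\<phi> 0 x = x" and sol: "solves_ode_on F (\<lambda>t. \<phi> t x) {0..b}" for x b
    using solves_ode_on_subset[OF _ subset_UNIV] unfolding is_flow_of_def by blast+
  have "\<kappa> \<ge> 0"
    using F[of c] by simp
  \<comment> \<open>The margin of one above the limiting level \<open>\<kappa> / \<delta>\<close>
    turns asymptotic approach into entry after a finite time.\<close>
  define \<rho> where "\<rho> = sqrt (\<kappa> / \<delta> + 1)"
  have \<rho>: "\<rho>\<^sup>2 = \<kappa> / \<delta> + 1" "\<rho> \<ge> 0"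
    using \<open>\<kappa> \<ge> 0\<close> \<open>\<delta> > 0\<close> by (auto simp: \<rho>_def)
  have decay: "(norm (\<phi> t x - c))\<^sup>2 - \<kappa> / \<delta> \<le> ((norm (x - c))\<^sup>2 - \<kappa> / \<delta>) * exp (- 2 * \<delta> * t)"
    if "0 \<le> t" for t x
    using solves_ode_on_dissipative_le[OF \<open>\<delta> > 0\<close> F that sol] by (simp add: zero)
  have mem_K: "\<phi> t x \<in> cball c \<rho>"
    if "0 \<le> t" "((norm (x - c))\<^sup>2 - \<kappa> / \<delta>) * exp (- 2 * \<delta> * t) \<le> 1" for t x
  proof -
    have "(norm (\<phi> t x - c))\<^sup>2 \<le> \<rho>\<^sup>2"
      using decay[OF that(1), of x] that(2) \<rho>(1) by linarith
    then have "norm (\<phi> t x - c) \<le> \<rho>"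
      using \<rho>(2) by (rule power2_le_imp_le)
    then show ?thesis
      by (simp add: dist_norm norm_minus_commute)
  qed
  have "compact_global_attractor \<phi> (\<Inter>t\<in>{0..}. \<phi> t ` cball c \<rho>)"
  proof (rule compact_global_attractor_exists)
    show "\<phi> 0 x = x" for x
      by (rule zero)
    show "\<phi> (s + t) x = \<phi> s (\<phi> t x)" for s t x
      using \<phi> by (rule is_flow_of_add)
    show "compact (cball c \<rho>)"
      by simp
    show "continuous_on (cball c \<rho>) (\<phi> t)" if "0 \<le> t" for t
    proof (rule continuous_on_subset)
      show "continuous_on (cball 0 (norm c + \<rho>)) (\<phi> t)"
        using bound that by (intro is_flow_of_continuous_on[OF lip _ \<phi>]) (auto simp: abs_le_iff)
      show "cball c \<rho> \<subseteq> cball 0 (norm c + \<rho>)"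
        using \<rho>(2) by (simp add: cball_subset_cball_iff)
    qed
    show "\<phi> t ` cball c \<rho> \<subseteq> cball c \<rho>" if "0 \<le> t" for t
    proof
      fix y assume "y \<in> \<phi> t ` cball c \<rho>"
      then obtain x where x: "x \<in> cball c \<rho>" "y = \<phi> t x"
        by blast
      then have "norm (x - c) \<le> \<rho>"
        by (simp add: dist_norm norm_minus_commute)
      then have "(norm (x - c))\<^sup>2 \<le> \<rho>\<^sup>2"
        by (intro power_mono) auto
      then have "((norm (x - c))\<^sup>2 - \<kappa> / \<delta>) * exp (- 2 * \<delta> * t) \<le> 1 * 1"
        using \<rho>(1) \<open>\<delta> > 0\<close> that by (intro mult_mono) auto
      then show "y \<in> cball c \<rho>"
        using mem_K[OF that] x(2) by simp
    qed
    show "\<exists>T. \<forall>t\<ge>T. \<phi> t ` B \<subseteq> cball c \<rho>" if "bounded B" for B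
    proof -
      obtain m where m: "\<And>x. x \<in> B \<Longrightarrow> dist c x \<le> m"
        using \<open>bounded B\<close> bounded_any_center[of B c] by auto
      \<comment> \<open>This entry time suffices because \<open>exp s \<ge> 1 + s\<close> gives
        \<open>m\<^sup>2 \<le> exp (2 * \<delta> * t)\<close>.\<close>
      have "\<phi> t x \<in> cball c \<rho>" if t: "t \<ge> m\<^sup>2 / (2 * \<delta>)" and "x \<in> B" for t x
      proof -
        have "0 \<le> m\<^sup>2 / (2 * \<delta>)"
          using \<open>\<delta> > 0\<close> by simp
        with t have "0 \<le> t"
          by linarith
        have "(norm (x - c))\<^sup>2 \<le> m\<^sup>2"
          using m[OF \<open>x \<in> B\<close>] by (intro power_mono) (auto simp: dist_norm norm_minus_commute)
        moreover have "0 \<le> \<kappa> / \<delta>"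
          using \<open>\<kappa> \<ge> 0\<close> \<open>\<delta> > 0\<close> by simp
        moreover have "m\<^sup>2 \<le> 2 * \<delta> * t"
          using t \<open>\<delta> > 0\<close> by (simp add: pos_divide_le_eq mult.commute)
        ultimately have "(norm (x - c))\<^sup>2 - \<kappa> / \<delta> \<le> exp (2 * \<delta> * t)"
          using exp_ge_add_one_self[of "2 * \<delta> * t"] by linarith
        then have "((norm (x - c))\<^sup>2 - \<kappa> / \<delta>) * exp (- 2 * \<delta> * t)
            \<le> exp (2 * \<delta> * t) * exp (- 2 * \<delta> * t)"
          by (intro mult_right_mono) auto
        also have "\<dots> = 1"
          by (simp flip: exp_add)
        finally show ?thesis
          using mem_K \<open>0 \<le> t\<close> by blast
      qed
      then show ?thesis
        by blast
    qed
  qed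
  with \<phi> show ?thesis
    unfolding possesses_compact_global_attractor_def by blast
qed

text \<open>Half of the damping absorbs the linear term by completing a square; the other half is
  recentred at \<open>c\<close> through the parallelogram law.\<close>

lemma dissipative_of_quadratic_bound:
  fixes x c l v :: "'a::real_inner"
  assumes "m > 0" and F: "(x - c) \<bullet> v \<le> l \<bullet> x - m * (norm x)\<^sup>2"
  shows "(x - c) \<bullet> v \<le> m / 2 * (norm c)\<^sup>2 + (norm l)\<^sup>2 / (2 * m) - m / 4 * (norm (x - c))\<^sup>2"
proof -
  have "0 \<le> (norm (m *\<^sub>R x - l))\<^sup>2 / (2 * m)"
    using \<open>m > 0\<close> by simp
  also have "\<dots> = m / 2 * (norm x)\<^sup>2 + (norm l)\<^sup>2 / (2 * m) - l \<bullet> x"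
    using \<open>m > 0\<close> unfolding power2_norm_eq_inner
    by (simp add: inner_diff inner_commute field_simps power2_eq_square)
  finally have "l \<bullet> x \<le> m / 2 * (norm x)\<^sup>2 + (norm l)\<^sup>2 / (2 * m)"
    by simp
  moreover have "m / 4 * (norm (x - c))\<^sup>2 \<le> m / 4 * (2 * (norm x)\<^sup>2 + 2 * (norm c)\<^sup>2)"
  proof (rule mult_left_mono)
    have "0 \<le> (norm (x + c))\<^sup>2"
      by simp
    then show "(norm (x - c))\<^sup>2 \<le> 2 * (norm x)\<^sup>2 + 2 * (norm c)\<^sup>2"
      unfolding power2_norm_eq_inner by (simp add: inner_diff inner_add inner_commute)
  qed (use \<open>m > 0\<close> in simp)
  ultimately show ?thesis
    using F by (simp add: field_simps)
qed

section \<open>Lipschitz bounds for polynomial maps\<close>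

lemma real_polynomial_function_lipschitz_on:
  assumes "real_polynomial_function p" "compact S"
  shows "\<exists>L. L-lipschitz_on S p"
  using assms(1)
proof induction
  case (linear f)
  then obtain B where "\<And>x. norm (f x) \<le> norm x * B" "B \<ge> 0"
    using bounded_linear.nonneg_bounded by metis
  then have "B-lipschitz_on S f"
    using linear by (intro lipschitz_onI)
      (auto simp: dist_norm mult.commute simp flip: linear_diff[OF bounded_linear.linear])
  then show ?case ..
next
  case (const c)
  show ?case
    using lipschitz_on_constant by blast
next
  case (add f g)
  then show ?case
    by (blast intro: lipschitz_on_add)
next
  case (mult f g)
  then obtain L M where L: "L-lipschitz_on S f" and M: "M-lipschitz_on S g"
    by blast
  obtain A B where A: "\<And>x. x \<in> S \<Longrightarrow> \<bar>f x\<bar> \<le> A" and B: "\<And>x. x \<in> S \<Longrightarrow> \<bar>g x\<bar> \<le> B"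
    using compact_imp_bounded[OF compact_continuous_image[OF lipschitz_on_continuous_on[OF L] assms(2)]]
      compact_imp_bounded[OF compact_continuous_image[OF lipschitz_on_continuous_on[OF M] assms(2)]]
    by (auto simp: bounded_iff)
  \<comment> \<open>Products need bounded factors, hence compactness of \<open>S\<close>. The
    absolute values keep the constant nonnegative when \<open>S\<close> is empty and
    \<open>A\<close> or \<open>B\<close> may be negative.\<close>
  have "(\<bar>A\<bar> * M + L * \<bar>B\<bar>)-lipschitz_on S (\<lambda>x. f x * g x)"
  proof (rule lipschitz_onI)
    fix x y assume S: "x \<in> S" "y \<in> S"
    have "f x * g x - f y * g y = f x * (g x - g y) + (f x - f y) * g y"
      by (simp add: algebra_simps)
    then have "dist (f x * g x) (f y * g y) \<le> \<bar>f x\<bar> * dist (g x) (g y) + dist (f x) (f y) * \<bar>g y\<bar>"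
      using abs_triangle_ineq[of "f x * (g x - g y)" "(f x - f y) * g y"]
      by (simp add: dist_real_def abs_mult)
    also have "\<dots> \<le> \<bar>A\<bar> * (M * dist x y) + (L * dist x y) * \<bar>B\<bar>"
      using A[OF S(1)] B[OF S(2)] lipschitz_onD[OF L S] lipschitz_onD[OF M S] lipschitz_on_nonneg[OF L]
      by (intro add_mono mult_mono) auto
    finally show "dist (f x * g x) (f y * g y) \<le> (\<bar>A\<bar> * M + L * \<bar>B\<bar>) * dist x y"
      by (simp add: algebra_simps)
  qed (use lipschitz_on_nonneg[OF L] lipschitz_on_nonneg[OF M] in simp)
  then show ?case ..
qed

lemma polynomial_function_lipschitz_on_balls:
  fixes p :: "'a::euclidean_space \<Rightarrow> 'b::euclidean_space"
  assumes "polynomial_function p"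
  shows "lipschitz_on_balls p"
  unfolding lipschitz_on_balls_def
proof
  fix M
  have "\<forall>b\<in>Basis. \<exists>L. L-lipschitz_on (cball 0 M) (\<lambda>x. p x \<bullet> b)"
    using assms by (auto simp: polynomial_function_iff_Basis_inner
        intro!: real_polynomial_function_lipschitz_on)
  then obtain L where L: "\<And>b. b \<in> Basis \<Longrightarrow> (L b)-lipschitz_on (cball 0 M) (\<lambda>x. p x \<bullet> b)"
    by metis
  have "(\<Sum>b\<in>Basis. L b)-lipschitz_on (cball 0 M) p"
  proof (rule lipschitz_onI)
    fix x y :: 'a assume S: "x \<in> cball 0 M" "y \<in> cball 0 M"
    have "dist (p x) (p y) \<le> (\<Sum>b\<in>Basis. \<bar>(p x - p y) \<bullet> b\<bar>)"
      unfolding dist_norm by (rule norm_le_l1)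
    also have "\<dots> \<le> (\<Sum>b\<in>Basis. L b * dist x y)"
      using lipschitz_onD[OF L S] by (intro sum_mono) (simp add: dist_real_def inner_diff_left)
    finally show "dist (p x) (p y) \<le> (\<Sum>b\<in>Basis. L b) * dist x y"
      by (simp add: sum_distrib_right)
  qed (use lipschitz_on_nonneg[OF L] in \<open>auto intro: sum_nonneg\<close>)
  then show "\<exists>L. L-lipschitz_on (cball 0 M) p" ..
qed

section \<open>The five-dimensional system\<close>

lemma exhaust_5: "x = 1 \<or> x = 2 \<or> x = 3 \<or> x = 4 \<or> x = 5" for x :: 5
proof (induct x)
  case (of_int z)
  \<comment> \<open>Numerals of type \<open>5\<close> are read modulo five, so the representative
    \<open>0\<close> is the index \<open>5\<close>.\<close>
  then have "z = 0 \<or> z = 1 \<or> z = 2 \<or> z = 3 \<or> z = 4"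
    by auto
  then show ?case by auto
qed

lemma UNIV_5: "UNIV = {1, 2, 3, 4, 5::5}"
  using exhaust_5 by auto

lemma sum_5: "sum f (UNIV::5 set) = f 1 + f 2 + f 3 + f 4 + f 5"
  unfolding UNIV_5 by (simp add: ac_simps)

lemma vector_5 [simp]:
  "(vector [a, b, c, d, e] :: 'a::zero ^ 5) $ 1 = a"
  "(vector [a, b, c, d, e] :: 'a::zero ^ 5) $ 2 = b"
  "(vector [a, b, c, d, e] :: 'a::zero ^ 5) $ 3 = c"
  "(vector [a, b, c, d, e] :: 'a::zero ^ 5) $ 4 = d"
  "(vector [a, b, c, d, e] :: 'a::zero ^ 5) $ 5 = e"
  unfolding vector_def by simp_all

theorem lemma4p3:
  fixes \<kappa>\<^sub>1 \<kappa>\<^sub>2 \<kappa>\<^sub>3 I\<^sub>1 I\<^sub>2 I\<^sub>3 g\<^sub>1 g\<^sub>2 P R :: real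
  assumes "\<kappa>\<^sub>1 > 0" "\<kappa>\<^sub>2 > 0" "\<kappa>\<^sub>3 > 0" "I\<^sub>1 > 0" "P > 0"
    and "g\<^sub>1 \<noteq> 0" "I\<^sub>3 \<noteq> 0"
  shows "possesses_compact_global_attractor (\<lambda>X :: real ^ 5.
    (vector
      [vector [- P * \<kappa>\<^sub>1, 0, P * R * g\<^sub>1, 0, 0],
       vector [0, - P * \<kappa>\<^sub>2, 0, P * R * g\<^sub>2, 0],
       vector [g\<^sub>1, 0, - \<kappa>\<^sub>1, 0, 0],
       vector [0, g\<^sub>2, 0, - \<kappa>\<^sub>2, 0],
       vector [0, 0, 0, 0, - \<kappa>\<^sub>3]] :: real ^ 5 ^ 5) *v X
    + vector
      [I\<^sub>1 * X $ 1 * X $ 2,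
       - I\<^sub>1 * (X $ 1)\<^sup>2,
       I\<^sub>2 * X $ 1 * X $ 4,
       - I\<^sub>2 * X $ 1 * X $ 3 - I\<^sub>3 * X $ 2 * X $ 5,
       I\<^sub>3 * X $ 2 * X $ 4])"
    (is "possesses_compact_global_attractor (\<lambda>X. ?A *v X + ?N X)")
proof -
  \<comment> \<open>The two couplings of \<open>X $ 1\<close> with \<open>X $ 3\<close> add up to
    \<open>a * g\<^sub>1\<close>, those of \<open>X $ 2\<close> with \<open>X $ 4\<close> to
    \<open>a * g\<^sub>2\<close>.\<close>
  define a where "a = P * R + 1"
  \<comment> \<open>\<open>c\<^sub>2\<close> completes the square in \<open>X $ 1\<close> and \<open>X $ 3\<close>; \<open>c\<^sub>5\<close> cancels the term in \<open>X $ 2 * X $ 4\<close>.\<close>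
  define c\<^sub>2 where "c\<^sub>2 = - (a * g\<^sub>1)\<^sup>2 / (2 * \<kappa>\<^sub>1 * I\<^sub>1)"
  define c\<^sub>5 where "c\<^sub>5 = a * g\<^sub>2 / I\<^sub>3"
  define c :: "real ^ 5" where "c = vector [0, c\<^sub>2, 0, 0, c\<^sub>5]"
  \<comment> \<open>Collects the linear terms that the shift by \<open>c\<close> produces from the
    linear part of the field.\<close>
  define l :: "real ^ 5" where
    "l = vector [0, c\<^sub>2 * P * \<kappa>\<^sub>2, 0, - c\<^sub>2 * P * R * g\<^sub>2, c\<^sub>5 * \<kappa>\<^sub>3]"
  \<comment> \<open>The weakest remaining damping; \<open>\<kappa>\<^sub>1 / 2\<close> appears
    because half of the damping of \<open>X $ 3\<close> is spent on the square with
    \<open>X $ 1\<close>.\<close>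
  define m where "m = Min {P * \<kappa>\<^sub>1, P * \<kappa>\<^sub>2, \<kappa>\<^sub>1 / 2, \<kappa>\<^sub>2, \<kappa>\<^sub>3}"
  have m: "m \<le> P * \<kappa>\<^sub>1" "m \<le> P * \<kappa>\<^sub>2" "m \<le> \<kappa>\<^sub>1 / 2" "m \<le> \<kappa>\<^sub>2" "m \<le> \<kappa>\<^sub>3"
    unfolding m_def by (rule Min_le; simp)+
  have "m > 0"
    using assms unfolding m_def by (subst Min_gr_iff) auto
  have dissipative: "(X - c) \<bullet> (?A *v X + ?N X) \<le> l \<bullet> X - m * (norm X)\<^sup>2" for X
  proof -
    define v where "v = ?A *v X + ?N X"
    have v:
      "v $ 1 = - P * \<kappa>\<^sub>1 * X $ 1 + P * R * g\<^sub>1 * X $ 3 + I\<^sub>1 * X $ 1 * X $ 2"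
      "v $ 2 = - P * \<kappa>\<^sub>2 * X $ 2 + P * R * g\<^sub>2 * X $ 4 - I\<^sub>1 * (X $ 1)\<^sup>2"
      "v $ 3 = g\<^sub>1 * X $ 1 - \<kappa>\<^sub>1 * X $ 3 + I\<^sub>2 * X $ 1 * X $ 4"
      "v $ 4 = g\<^sub>2 * X $ 2 - \<kappa>\<^sub>2 * X $ 4 - I\<^sub>2 * X $ 1 * X $ 3 - I\<^sub>3 * X $ 2 * X $ 5"
      "v $ 5 = - \<kappa>\<^sub>3 * X $ 5 + I\<^sub>3 * X $ 2 * X $ 4"
      unfolding v_def by (simp_all add: matrix_vector_mult_def sum_5)
    \<comment> \<open>All cubic terms cancel, leaving a quadratic form plus
      \<open>l \<bullet> X\<close>.\<close>
    have "(X - c) \<bullet> v = l \<bullet> X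
        - P * \<kappa>\<^sub>1 * (X $ 1)\<^sup>2 - P * \<kappa>\<^sub>2 * (X $ 2)\<^sup>2 - \<kappa>\<^sub>1 * (X $ 3)\<^sup>2
        - \<kappa>\<^sub>2 * (X $ 4)\<^sup>2 - \<kappa>\<^sub>3 * (X $ 5)\<^sup>2
        + a * g\<^sub>1 * X $ 1 * X $ 3 + (c\<^sub>2 * I\<^sub>1) * (X $ 1)\<^sup>2
        + (a * g\<^sub>2 - c\<^sub>5 * I\<^sub>3) * X $ 2 * X $ 4"
    proof -
      have "(X - c) \<bullet> v = X $ 1 * v $ 1 + (X $ 2 - c\<^sub>2) * v $ 2 + X $ 3 * v $ 3
          + X $ 4 * v $ 4 + (X $ 5 - c\<^sub>5) * v $ 5"
        by (simp add: inner_vec_def sum_5 c_def)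
      moreover have "l \<bullet> X = c\<^sub>2 * P * \<kappa>\<^sub>2 * X $ 2 - c\<^sub>2 * P * R * g\<^sub>2 * X $ 4 + c\<^sub>5 * \<kappa>\<^sub>3 * X $ 5"
        by (simp add: inner_vec_def sum_5 l_def)
      ultimately show ?thesis
        unfolding v a_def by algebra
    qed
    moreover have "(c\<^sub>2 * I\<^sub>1) * (X $ 1)\<^sup>2 = - ((a * g\<^sub>1)\<^sup>2 / (2 * \<kappa>\<^sub>1) * (X $ 1)\<^sup>2)"
      "a * g\<^sub>2 - c\<^sub>5 * I\<^sub>3 = 0"
      using assms by (auto simp: c\<^sub>2_def c\<^sub>5_def)
    moreover have "\<kappa>\<^sub>1 / 2 * (X $ 3 - a * g\<^sub>1 / \<kappa>\<^sub>1 * X $ 1)\<^sup>2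
        = \<kappa>\<^sub>1 / 2 * (X $ 3)\<^sup>2 - a * g\<^sub>1 * X $ 1 * X $ 3 + (a * g\<^sub>1)\<^sup>2 / (2 * \<kappa>\<^sub>1) * (X $ 1)\<^sup>2"
      using assms by (simp add: power2_eq_square field_simps)
    moreover have "\<kappa>\<^sub>1 / 2 * (X $ 3 - a * g\<^sub>1 / \<kappa>\<^sub>1 * X $ 1)\<^sup>2 \<ge> 0"
      using assms by simp
    moreover have "m * (norm X)\<^sup>2
        = m * (X $ 1)\<^sup>2 + m * (X $ 2)\<^sup>2 + m * (X $ 3)\<^sup>2 + m * (X $ 4)\<^sup>2 + m * (X $ 5)\<^sup>2"
      unfolding power2_norm_eq_inner inner_vec_def
      by (simp add: sum_5 power2_eq_square distrib_left)
    ultimately have "(X - c) \<bullet> v \<le> l \<bullet> X - m * (norm X)\<^sup>2"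
      using mult_right_mono[OF m(1) zero_le_power2[of "X $ 1"]]
        mult_right_mono[OF m(2) zero_le_power2[of "X $ 2"]]
        mult_right_mono[OF m(3) zero_le_power2[of "X $ 3"]]
        mult_right_mono[OF m(4) zero_le_power2[of "X $ 4"]]
        mult_right_mono[OF m(5) zero_le_power2[of "X $ 5"]]
      by simp
    then show ?thesis
      by (simp only: v_def)
  qed
  \<comment> \<open>The nonlinearity does no work, so the growth bound involves the matrix
    alone.\<close>
  have energy: "X \<bullet> ?N X = 0" for X :: "real ^ 5"
    unfolding inner_vec_def by (simp add: sum_5 algebra_simps power2_eq_square)
  obtain C where C: "\<And>X. norm (?A *v X) \<le> norm X * C"
    using bounded_linear.bounded[OF matrix_vector_mul_bounded_linear] by metis
  show ?thesis
  proof (rule dissipative_possesses_compact_global_attractor)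
    show "lipschitz_on_balls (\<lambda>X. ?A *v X + ?N X)"
    proof (rule polynomial_function_lipschitz_on_balls)
      have nth: "real_polynomial_function (\<lambda>X :: real ^ 5. X $ i)" for i
        by (intro real_polynomial_function.intros bounded_linear_vec_nth)
      have "polynomial_function ?N"
        unfolding polynomial_function_iff_Basis_inner
      proof
        fix b :: "real ^ 5" assume "b \<in> Basis"
        then obtain i where "b = axis i 1"
          by (auto simp: Basis_vec_def)
        moreover have "real_polynomial_function (\<lambda>X. ?N X $ i)"
          using exhaust_5[of i]
          by (elim disjE)
            (simp_all add: power2_eq_square,
              (intro real_polynomial_function.intros real_polynomial_function_diff
                real_polynomial_function_minus nth)+)
        ultimately show "real_polynomial_function (\<lambda>X. ?N X \<bullet> b)"
          by (simp add: inner_axis)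
      qed
      then show "polynomial_function (\<lambda>X. ?A *v X + ?N X)"
        by (rule polynomial_function_add[OF
            polynomial_function_bounded_linear[OF matrix_vector_mul_bounded_linear]])
    qed
    show "\<bar>X \<bullet> (?A *v X + ?N X)\<bar> \<le> C * (norm X)\<^sup>2" for X
    proof -
      have "\<bar>X \<bullet> (?A *v X + ?N X)\<bar> = \<bar>X \<bullet> (?A *v X)\<bar>"
        by (simp only: inner_add_right energy add_0_right)
      also have "\<dots> \<le> norm X * norm (?A *v X)"
        by (rule Cauchy_Schwarz_ineq2)
      also have "\<dots> \<le> norm X * (norm X * C)"
        using C by (intro mult_left_mono) auto
      finally show ?thesis
        by (simp add: power2_eq_square mult.commute mult.left_commute)
    qed
    show "(X - c) \<bullet> (?A *v X + ?N X)
        \<le> m / 2 * (norm c)\<^sup>2 + (norm l)\<^sup>2 / (2 * m) - m / 4 * (norm (X - c))\<^sup>2" for X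
      using \<open>m > 0\<close> dissipative by (rule dissipative_of_quadratic_bound)
  qed (use \<open>m > 0\<close> in simp)
qed

end
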